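(* In the setting of the context (homogeneous pure Neumann case), let $u^{in}\in L^2(\Omega)$, $u^{in}\ge0$, $M=\int_\Omega u^{in}>0$, and let $(\underline u^n_{\mathcal{D}})_{n\ge1}$ be a (positive) solution to the nonlinear scheme. The discrete entropy $\mathbb{E}^n=\int_\Omega u^\infty_{\mathcal{M}}\Phi_1\big(\frac{u^n_{\mathcal{M}}}{u^\infty_{\mathcal{M}}}\big)$ decays exponentially fast in time: there is $\nu_{\mathrm{nl}}:=\frac{4u^\infty_\flat\lambda_\flat\alpha_\flat}{C_FC_{LS,\infty}^2}>0$, depending on $\Lambda,\phi,M,\Omega,d$ and $\theta_{\mathcal{D}}$, such that $$\forall n\in\mathbb{N},\qquad\mathbb{E}^{n+1}\le(1+\nu_{\mathrm{nl}}\Delta t)^{-1}\mathbb{E}^n.$$ Consequently, for all $n\ge1$, $$\|u^n_{\mathcal{M}}-u^\infty_{\mathcal{M}}\|_{L^1(\Omega)}\le\sqrt{2M\mathbb{E}^0}\,(1+\nu_{\mathrm{nl}}\Delta t)^{-\frac n2}.$$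
   Context: **Data.** $\Omega\subset\mathbb{R}^d$, $d\in\{2,3\}$, is open, bounded, connected and polytopal. $\Lambda\in L^\infty(\Omega;\mathbb{R}^{d\times d})$ is symmetric with, for some $0<\lambda_\flat\le\lambda_\sharp<\infty$, $\xi\cdot\Lambda(x)\xi\ge\lambda_\flat|\xi|^2$ and $|\Lambda(x)\xi|\le\lambda_\sharp|\xi|$ for a.e. $x\in\Omega$ and all $\xi\in\mathbb{R}^d$. $\phi\in C^1(\overline\Omega)$, with $\Lambda\nabla\phi\in H(\mathrm{div};\Omega)$, $\omega:=e^{-\phi}$, and $0<\omega_\flat\le\omega_\sharp$ (depending only on $\phi,\Omega$) satisfy $\omega_\flat\le\omega\le\omega_\sharp$. $\Delta t>0$ is fixed. $\Phi_1(s)=s\log s-s+1$ for $s>0$, $\Phi_1(0)=1$. **Discretisation.** A discretisation of $\Omega$ is a triplet $\mathcal{D}=(\mathcal{M},\mathcal{E},\mathcal{P})$. $\mathcal{M}$ is a finite family of nonempty disjoint open connected polytopal subsets $K$ of $\Omega$ (cells) with $|K|>0$ and $\overline\Omega=\bigcup_K\overline K$. $\mathcal{E}$ is a finite family of nonempty disjoint (relatively open) connected subsets $\sigma$ of $\overline\Omega$ (faces), each of positive $(d-1)$-dimensional measure $|\sigma|$ and contained in an affine hyperplane $\mathcal{H}_\sigma$, with $\bigcup_K\partial K=\bigcup_\sigma\overline\sigma$; for each $K$ there is $\mathcal{E}_K\subset\mathcal{E}$ with $\partial K=\bigcup_{\sigma\in\mathcal{E}_K}\overline\sigma$. With $\mathcal{M}_\sigma=\{K:\sigma\in\mathcal{E}_K\}$,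 each $\sigma$ is either a boundary face ($\mathcal{M}_\sigma=\{K\}$, $\sigma\subset\partial\Omega$) or an interface ($\mathcal{M}_\sigma=\{K,L\}$). $\mathcal{P}=\{x_K\}_{K\in\mathcal{M}}$ with $x_K\in K$, $K$ star-shaped with respect to $x_K$, and the distance $d_{K,\sigma}$ from $x_K$ to $\mathcal{H}_\sigma$ positive for all $\sigma\in\mathcal{E}_K$. $h_K$ is the diameter of $K$, $\overline{x}_\sigma$ the barycentre of $\sigma$, $n_{K,\sigma}$ the unit normal to $\sigma$ outward to $K$, $P_{K,\sigma}$ the open pyramid with base $\sigma$ and apex $x_K$, and $\theta_{\mathcal{D}}=\max\big(\max_{K,\sigma\in\mathcal{E}_K}\frac{h_K}{d_{K,\sigma}},\max_{\sigma,K\in\mathcal{M}_\sigma}\frac{h_K^{d-1}}{|\sigma|}\big)$. **Unknowns.** $\underline{V}_{\mathcal{D}}$ is the space of real vectors $\underline{v}_{\mathcal{D}}=((v_K)_{K\in\mathcal{M}},(v_\sigma)_{\sigma\in\mathcal{E}})$; $\underline{v}_K=(v_K,(v_\sigma)_{\sigma\in\mathcal{E}_K})$; $v_{\mathcal{M}}$ is the piecewise constant function equal to $v_K$ on $K$; $(\cdot,\cdot)_\Omega$ is the $L^2(\Omega)$ inner product; $|\underline v_{\mathcal{D}}|_{1,\mathcal{D}}^2=\sum_K\sum_{\sigma\in\mathcal{E}_K}\frac{|\sigma|}{d_{K,\sigma}}(v_K-v_\sigma)^2$. A vector is positive if all its coordinates are. $\omega_K=\frac1{|K|}\int_K\omega$,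 $\omega_\sigma=\frac1{|\sigma|}\int_\sigma\omega$; $\underline{u}^\infty_{\mathcal{D}}:=\frac{M}{\int_\Omega\omega}\underline{\omega}_{\mathcal{D}}$ (the discrete steady-state); $u^\infty_\flat=\frac{M\omega_\flat}{|\Omega|\omega_\sharp}$, $u^\infty_\sharp=\frac{M\omega_\sharp}{|\Omega|\omega_\flat}$, so all coordinates of $\underline u^\infty_{\mathcal{D}}$ lie in $[u^\infty_\flat,u^\infty_\sharp]$. **Bilinear form.** With a fixed $\eta>0$, $\nabla_K\underline v_K$ equals on $P_{K,\sigma}$ the vector $G_K\underline v_K+\frac{\eta}{d_{K,\sigma}}\big(v_\sigma-v_K-G_K\underline v_K\cdot(\overline x_\sigma-x_K)\big)n_{K,\sigma}$, where $G_K\underline v_K=\frac1{|K|}\sum_{\sigma'\in\mathcal{E}_K}|\sigma'|(v_{\sigma'}-v_K)n_{K,\sigma'}$; $a^\Lambda_K(\underline u_K,\underline v_K)=\int_K\Lambda\nabla_K\underline u_K\cdot\nabla_K\underline v_K$. **Nonlinear scheme.** For positive $\underline u_{\mathcal{D}}$, $\underline w_{\mathcal{D}}(\underline u_{\mathcal{D}})$ has coordinates $w_K=\log(u_K/u_K^\infty)$, $w_\sigma=\log(u_\sigma/u_\sigma^\infty)$, and $T_{\mathcal{D}}(\underline u_{\mathcal{D}},\underline w_{\mathcal{D}},\underline v_{\mathcal{D}})=\sum_{K}r_K(\underline u_K)a_K^\Lambda(\underline w_K,\underline v_K)$ with $r_K(\underline u_K)=f_{|\mathcal{E}_K|}((m(u_K,u_\sigma))_{\sigma\in\mathcal{E}_K})$,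 where $f_k(x_1,\dots,x_k)$ is either $\frac1k\sum_i x_i$ or $\max_i x_i$, and $m:(0,\infty)^2\to(0,\infty)$ is a fixed function, non-decreasing in both variables, with $m(x,x)=x$, $m(x,y)=m(y,x)$, $m(\lambda x,\lambda y)=\lambda m(x,y)$ for $\lambda,x,y>0$, and $\frac{y-x}{\log y-\log x}\le m(x,y)\le\max(x,y)$ for $x\ne y$. A positive solution is a sequence of positive vectors $(\underline u^n_{\mathcal{D}})_{n\ge1}$ with $\frac{1}{\Delta t}(u^n_{\mathcal{M}}-u^{n-1}_{\mathcal{M}},v_{\mathcal{M}})_\Omega+T_{\mathcal{D}}(\underline{u}^n_{\mathcal{D}},\underline{w}_{\mathcal{D}}(\underline{u}^n_{\mathcal{D}}),\underline{v}_{\mathcal{D}})=0$ for all $\underline{v}_{\mathcal{D}}\in\underline{V}_{\mathcal{D}}$, $n\ge1$, and $u^0_K=\frac{1}{|K|}\int_Ku^{in}$. **Constants.** $\alpha_\flat>0$ depends only on $\Omega,d,\theta_{\mathcal{D}}$ and satisfies $\alpha_\flat\sum_{\sigma\in\mathcal{E}_K}\frac{|\sigma|}{d_{K,\sigma}}(v_K-v_\sigma)^2\le\|\nabla_K\underline v_K\|^2_{L^2(K;\mathbb{R}^d)}$ for all $K,\underline v_K$. $C_F>0$, only depending on $\Lambda,\Omega,d,\theta_{\mathcal{D}}$, is such that $\hat{\mathbb{D}}^n\le C_F\mathbb{D}^n$ for all $n\ge1$, where $\mathbb{D}^n=T_{\mathcal{D}}(\underline u^n_{\mathcal{D}},\underline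 w^n_{\mathcal{D}},\underline w^n_{\mathcal{D}})$ with $\underline w^n_{\mathcal{D}}=\underline w_{\mathcal{D}}(\underline u^n_{\mathcal{D}})$, $\hat{\mathbb{D}}^n=4\sum_K\min(u^\infty_K,\min_{\sigma\in\mathcal{E}_K}u^\infty_\sigma)\,a_K^\Lambda(\underline\xi^n_K,\underline\xi^n_K)$, $\xi^n_K=\sqrt{u^n_K/u^\infty_K}$, $\xi^n_\sigma=\sqrt{u^n_\sigma/u^\infty_\sigma}$. $C_{LS,\infty}>0$, only depending on $M$, $\sup_Ku^\infty_K$, $\Omega,d,\theta_{\mathcal{D}}$, is such that $\int_\Omega u^\infty_{\mathcal{M}}\Phi_1(\xi_{\mathcal{M}}^2)\le C_{LS,\infty}^2|\underline\xi_{\mathcal{D}}|_{1,\mathcal{D}}^2$ for every positive $\underline v_{\mathcal{D}}$ with $\int_\Omega v_{\mathcal{M}}=M$ and $\xi_K=\sqrt{v_K/u^\infty_K}$, $\xi_\sigma=\sqrt{v_\sigma/u^\infty_\sigma}$. *)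

theory Defs
  imports "HOL-Analysis.Analysis"
begin

definition L2_on :: "(real^'d) set \<Rightarrow> (real^'d \<Rightarrow> 'b::euclidean_space) \<Rightarrow> bool" where
  "L2_on \<Omega> f \<longleftrightarrow> f \<in> borel_measurable (lebesgue_on \<Omega>) \<and>
     integrable (lebesgue_on \<Omega>) (\<lambda>x. (norm (f x))\<^sup>2)"

definition partial_deriv :: "'d \<Rightarrow> (real^'d \<Rightarrow> real) \<Rightarrow> real^'d \<Rightarrow> real" where
  "partial_deriv i f x = frechet_derivative f (at x) (axis i 1)"

definition gradient :: "(real^'d \<Rightarrow> real) \<Rightarrow> real^'d \<Rightarrow> real^'d" where
  "gradient f x = (\<chi> i. partial_deriv i f x)"

text \<open>\<open>k\<close>-fold differentiability on the whole space; requiring it for every \<open>k\<close> gives the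
  smooth functions.\<close>

primrec times_differentiable :: "nat \<Rightarrow> (real^'d \<Rightarrow> real) \<Rightarrow> bool" where
  "times_differentiable 0 f \<longleftrightarrow> True"
| "times_differentiable (Suc k) f \<longleftrightarrow>
     (\<forall>x. f differentiable (at x)) \<and> (\<forall>i. times_differentiable k (partial_deriv i f))"

definition test_function :: "(real^'d) set \<Rightarrow> (real^'d \<Rightarrow> real) \<Rightarrow> bool" where
  "test_function \<Omega> \<psi> \<longleftrightarrow> (\<forall>k. times_differentiable k \<psi>) \<and>
     (\<exists>S. compact S \<and> S \<subseteq> \<Omega> \<and> (\<forall>x. x \<notin> S \<longrightarrow> \<psi> x = 0))"

definition H_div :: "(real^'d) set \<Rightarrow> (real^'d \<Rightarrow> real^'d) \<Rightarrow> bool" where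
  "H_div \<Omega> F \<longleftrightarrow> L2_on \<Omega> F \<and>
     (\<exists>g :: real^'d \<Rightarrow> real. L2_on \<Omega> g \<and>
        (\<forall>\<psi>. test_function \<Omega> \<psi> \<longrightarrow>
           (LINT x:\<Omega>|lebesgue. F x \<bullet> gradient \<psi> x) = - (LINT x:\<Omega>|lebesgue. g x * \<psi> x)))"

text \<open>\<open>C\<^sup>1\<close> up to the boundary: the function and its gradient on the open set \<open>\<Omega>\<close> extend
  continuously to the closure.\<close>

definition C1_closure :: "(real^'d) set \<Rightarrow> (real^'d \<Rightarrow> real) \<Rightarrow> bool" where
  "C1_closure \<Omega> \<phi> \<longleftrightarrow> continuous_on (closure \<Omega>) \<phi> \<and>
     (\<exists>g. continuous_on (closure \<Omega>) g \<and>
        (\<forall>x\<in>\<Omega>. (\<phi> has_derivative (\<lambda>h. g x \<bullet> h)) (at x)))"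

definition diffusion_tensor ::
  "(real^'d) set \<Rightarrow> (real^'d \<Rightarrow> real^'d^'d) \<Rightarrow> real \<Rightarrow> real \<Rightarrow> bool" where
  "diffusion_tensor \<Omega> \<Lambda> l\<^sub>b l\<^sub>s \<longleftrightarrow> 0 < l\<^sub>b \<and> l\<^sub>b \<le> l\<^sub>s \<and>
     \<Lambda> \<in> borel_measurable (lebesgue_on \<Omega>) \<and>
     (AE x in lebesgue_on \<Omega>. transpose (\<Lambda> x) = \<Lambda> x \<and>
        (\<forall>\<xi>. l\<^sub>b * (norm \<xi>)\<^sup>2 \<le> \<xi> \<bullet> (\<Lambda> x *v \<xi>) \<and> norm (\<Lambda> x *v \<xi>) \<le> l\<^sub>s * norm \<xi>))"

text \<open>An open bounded set is polytopal if its boundary is a finite union of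
  \<open>(d-1)\<close>-dimensional convex polytopes; the set itself need not be convex.\<close>

definition polytopal :: "(real^'d) set \<Rightarrow> bool" where
  "polytopal S \<longleftrightarrow> (\<exists>\<F>. finite \<F> \<and>
     (\<forall>P\<in>\<F>. polytope P \<and> aff_dim P = int CARD('d) - 1) \<and> frontier S = \<Union>\<F>)"

definition is_hyperplane :: "(real^'d) set \<Rightarrow> bool" where
  "is_hyperplane H \<longleftrightarrow> (\<exists>a b. a \<noteq> 0 \<and> H = {x. a \<bullet> x = b})"

text \<open>The \<open>(d-1)\<close>-dimensional Lebesgue measure on a hyperplane \<open>H\<close>: a set \<open>A \<subseteq> H\<close> gets the
  \<open>d\<close>-dimensional volume of the right prism of height 1 with mid-section \<open>A\<close>, and
  \<open>closest_point H\<close> is the orthogonal projection onto \<open>H\<close>.\<close>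

definition hyperplane_measure :: "(real^'d) set \<Rightarrow> (real^'d) measure" where
  "hyperplane_measure H =
     distr (restrict_space lborel {x. infdist x H \<le> 1/2}) borel (closest_point H)"

text \<open>A face is a nonempty relatively open subset of a hyperplane, which is then its affine
  hull.\<close>

definition face_measure :: "(real^'d) set \<Rightarrow> (real^'d) measure" where
  "face_measure \<sigma> = hyperplane_measure (affine hull \<sigma>)"

definition area :: "(real^'d) set \<Rightarrow> real" where
  "area \<sigma> = measure (face_measure \<sigma>) \<sigma>"

definition barycentre :: "(real^'d) set \<Rightarrow> real^'d" where
  "barycentre \<sigma> = (1 / area \<sigma>) *\<^sub>R (LINT x:\<sigma>|face_measure \<sigma>. x)"

abbreviation volume :: "(real^'d) set \<Rightarrow> real" where
  "volume K \<equiv> measure lebesgue K"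

text \<open>A mesh \<open>(\<M>, \<E>, \<P>)\<close>; \<open>faces_of D K\<close> is \<open>\<E>\<^sub>K\<close> and \<open>center D K\<close> is \<open>x\<^sub>K\<close>.\<close>

record ('d::finite) mesh =
  cells :: "(real^'d) set set"
  faces :: "(real^'d) set set"
  faces_of :: "(real^'d) set \<Rightarrow> (real^'d) set set"
  center :: "(real^'d) set \<Rightarrow> real^'d"

definition cells_of :: "'d::finite mesh \<Rightarrow> (real^'d) set \<Rightarrow> (real^'d) set set" where
  "cells_of D \<sigma> = {K \<in> cells D. \<sigma> \<in> faces_of D K}"

definition face_dist :: "'d::finite mesh \<Rightarrow> (real^'d) set \<Rightarrow> (real^'d) set \<Rightarrow> real" where
  "face_dist D K \<sigma> = infdist (center D K) (affine hull \<sigma>)"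

definition discretisation :: "(real^'d) set \<Rightarrow> 'd::finite mesh \<Rightarrow> bool" where
  "discretisation \<Omega> D \<longleftrightarrow>
     finite (cells D) \<and> disjoint (cells D) \<and>
     (\<forall>K\<in>cells D. K \<noteq> {} \<and> K \<subseteq> \<Omega> \<and> open K \<and> connected K \<and> polytopal K \<and> volume K > 0) \<and>
     closure \<Omega> = (\<Union>K\<in>cells D. closure K) \<and>
     finite (faces D) \<and> disjoint (faces D) \<and>
     (\<forall>\<sigma>\<in>faces D. \<sigma> \<noteq> {} \<and> \<sigma> \<subseteq> closure \<Omega> \<and> connected \<sigma> \<and>
        (\<exists>H. is_hyperplane H \<and> openin (top_of_set H) \<sigma>) \<and> area \<sigma> > 0) \<and>
     (\<Union>K\<in>cells D. frontier K) = (\<Union>\<sigma>\<in>faces D. closure \<sigma>) \<and>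
     (\<forall>K\<in>cells D. faces_of D K \<subseteq> faces D \<and> frontier K = (\<Union>\<sigma>\<in>faces_of D K. closure \<sigma>)) \<and>
     (\<forall>\<sigma>\<in>faces D.
        (\<exists>K. cells_of D \<sigma> = {K} \<and> \<sigma> \<subseteq> frontier \<Omega>) \<or>
        (\<exists>K L. K \<noteq> L \<and> cells_of D \<sigma> = {K, L})) \<and>
     (\<forall>K\<in>cells D. center D K \<in> K \<and> (\<forall>y\<in>K. closed_segment (center D K) y \<subseteq> K) \<and>
        (\<forall>\<sigma>\<in>faces_of D K. face_dist D K \<sigma> > 0))"

text \<open>For a cell that is star-shaped with respect to a point at positive distance from the
  hyperplanes of its faces, every face has the cell on exactly one side, so the unit normal
  below exists and is unique.\<close>

definition outward_normal :: "(real^'d) set \<Rightarrow> (real^'d) set \<Rightarrow> real^'d" where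
  "outward_normal K \<sigma> = (THE n. norm n = 1 \<and> (\<forall>x\<in>\<sigma>. \<forall>y\<in>\<sigma>. n \<bullet> (x - y) = 0) \<and>
     (\<forall>x\<in>\<sigma>. \<exists>e>0. \<forall>t. 0 < t \<and> t < e \<longrightarrow> x - t *\<^sub>R n \<in> K \<and> x + t *\<^sub>R n \<notin> K))"

definition pyramid :: "'d::finite mesh \<Rightarrow> (real^'d) set \<Rightarrow> (real^'d) set \<Rightarrow> (real^'d) set" where
  "pyramid D K \<sigma> = {(1 - t) *\<^sub>R center D K + t *\<^sub>R y | t y. 0 < t \<and> t < 1 \<and> y \<in> \<sigma>}"

definition regularity :: "'d::finite mesh \<Rightarrow> real" where
  "regularity D = max
     (Max {diameter K / face_dist D K \<sigma> | K \<sigma>. K \<in> cells D \<and> \<sigma> \<in> faces_of D K})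
     (Max {diameter K ^ (CARD('d) - 1) / area \<sigma> | K \<sigma>. \<sigma> \<in> faces D \<and> K \<in> cells_of D \<sigma>})"

text \<open>A hybrid vector has one value per cell and one per face. Values at sets that are not
  cells or faces of the mesh are never used, so quantifying over this type amounts to
  quantifying over the finite-dimensional space of unknowns.\<close>

record ('d::finite) hybrid =
  cval :: "(real^'d) set \<Rightarrow> real"
  fval :: "(real^'d) set \<Rightarrow> real"

definition positive :: "'d::finite mesh \<Rightarrow> 'd hybrid \<Rightarrow> bool" where
  "positive D v \<longleftrightarrow> (\<forall>K\<in>cells D. cval v K > 0) \<and> (\<forall>\<sigma>\<in>faces D. fval v \<sigma> > 0)"

definition recon :: "'d::finite mesh \<Rightarrow> 'd hybrid \<Rightarrow> real^'d \<Rightarrow> real" where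
  "recon D v x = (\<Sum>K\<in>cells D. cval v K * indicator K x)"

definition local_seminorm_sq :: "'d::finite mesh \<Rightarrow> (real^'d) set \<Rightarrow> 'd hybrid \<Rightarrow> real" where
  "local_seminorm_sq D K v =
     (\<Sum>\<sigma>\<in>faces_of D K. area \<sigma> / face_dist D K \<sigma> * (cval v K - fval v \<sigma>)\<^sup>2)"

definition seminorm_sq :: "'d::finite mesh \<Rightarrow> 'd hybrid \<Rightarrow> real" where
  "seminorm_sq D v = (\<Sum>K\<in>cells D. local_seminorm_sq D K v)"

definition avg_grad :: "'d::finite mesh \<Rightarrow> (real^'d) set \<Rightarrow> 'd hybrid \<Rightarrow> real^'d" where
  "avg_grad D K v = (1 / volume K) *\<^sub>R
     (\<Sum>\<sigma>\<in>faces_of D K. (area \<sigma> * (fval v \<sigma> - cval v K)) *\<^sub>R outward_normal K \<sigma>)"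

text \<open>The pyramids of a cell are pairwise disjoint, so the sum picks the value attached to the
  pyramid containing \<open>x\<close>; off the pyramids (a null set) the gradient is \<open>0\<close>.\<close>

definition discrete_grad ::
  "real \<Rightarrow> 'd::finite mesh \<Rightarrow> (real^'d) set \<Rightarrow> 'd hybrid \<Rightarrow> real^'d \<Rightarrow> real^'d" where
  "discrete_grad \<eta> D K v x =
     (\<Sum>\<sigma>\<in>faces_of D K. indicator (pyramid D K \<sigma>) x *\<^sub>R
        (avg_grad D K v +
         (\<eta> / face_dist D K \<sigma> *
            (fval v \<sigma> - cval v K - avg_grad D K v \<bullet> (barycentre \<sigma> - center D K)))
         *\<^sub>R outward_normal K \<sigma>))"

definition local_form ::
  "real \<Rightarrow> (real^'d \<Rightarrow> real^'d^'d) \<Rightarrow> 'd::finite mesh \<Rightarrow> (real^'d) set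
    \<Rightarrow> 'd hybrid \<Rightarrow> 'd hybrid \<Rightarrow> real" where
  "local_form \<eta> \<Lambda> D K u v =
     (LINT x:K|lebesgue. (\<Lambda> x *v discrete_grad \<eta> D K u x) \<bullet> discrete_grad \<eta> D K v x)"

definition weight :: "(real^'d \<Rightarrow> real) \<Rightarrow> real^'d \<Rightarrow> real" where
  "weight \<phi> x = exp (- \<phi> x)"

definition steady_state ::
  "(real^'d) set \<Rightarrow> (real^'d \<Rightarrow> real) \<Rightarrow> real \<Rightarrow> 'd::finite hybrid" where
  "steady_state \<Omega> \<phi> M = (let c = M / (LINT x:\<Omega>|lebesgue. weight \<phi> x) in
     \<lparr>cval = (\<lambda>K. c * (1 / volume K * (LINT x:K|lebesgue. weight \<phi> x))),
      fval = (\<lambda>\<sigma>. c * (1 / area \<sigma> * (LINT x:\<sigma>|face_measure \<sigma>. weight \<phi> x)))\<rparr>)"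

definition log_ratio :: "'d::finite hybrid \<Rightarrow> 'd hybrid \<Rightarrow> 'd hybrid" where
  "log_ratio u u' = \<lparr>cval = (\<lambda>K. ln (cval u K / cval u' K)), fval = (\<lambda>\<sigma>. ln (fval u \<sigma> / fval u' \<sigma>))\<rparr>"

definition sqrt_ratio :: "'d::finite hybrid \<Rightarrow> 'd hybrid \<Rightarrow> 'd hybrid" where
  "sqrt_ratio u u' = \<lparr>cval = (\<lambda>K. sqrt (cval u K / cval u' K)), fval = (\<lambda>\<sigma>. sqrt (fval u \<sigma> / fval u' \<sigma>))\<rparr>"

definition face_mean :: "(real^'d) set set \<Rightarrow> ((real^'d) set \<Rightarrow> real) \<Rightarrow> real" where
  "face_mean S g = (\<Sum>\<sigma>\<in>S. g \<sigma>) / real (card S)"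

definition face_max :: "(real^'d) set set \<Rightarrow> ((real^'d) set \<Rightarrow> real) \<Rightarrow> real" where
  "face_max S g = (MAX \<sigma>\<in>S. g \<sigma>)"

definition admissible_mean :: "(real \<Rightarrow> real \<Rightarrow> real) \<Rightarrow> bool" where
  "admissible_mean m \<longleftrightarrow>
     (\<forall>x>0. \<forall>y>0. m x y > 0 \<and> m x y = m y x \<and> m x x = x) \<and>
     (\<forall>x>0. \<forall>x'\<ge>x. \<forall>y>0. m x y \<le> m x' y \<and> m y x \<le> m y x') \<and>
     (\<forall>l>0. \<forall>x>0. \<forall>y>0. m (l * x) (l * y) = l * m x y) \<and>
     (\<forall>x>0. \<forall>y>0. x \<noteq> y \<longrightarrow> (y - x) / (ln y - ln x) \<le> m x y \<and> m x y \<le> max x y)"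

definition scheme_form ::
  "real \<Rightarrow> (real^'d \<Rightarrow> real^'d^'d) \<Rightarrow> ((real^'d) set set \<Rightarrow> ((real^'d) set \<Rightarrow> real) \<Rightarrow> real)
    \<Rightarrow> (real \<Rightarrow> real \<Rightarrow> real) \<Rightarrow> 'd::finite mesh \<Rightarrow> 'd hybrid \<Rightarrow> 'd hybrid \<Rightarrow> 'd hybrid \<Rightarrow> real" where
  "scheme_form \<eta> \<Lambda> f m D u w v =
     (\<Sum>K\<in>cells D. f (faces_of D K) (\<lambda>\<sigma>. m (cval u K) (fval u \<sigma>)) * local_form \<eta> \<Lambda> D K w v)"

text \<open>The time index \<open>0\<close> only carries the cell averages of the initial datum.\<close>

definition positive_solution ::
  "(real^'d) set \<Rightarrow> (real^'d \<Rightarrow> real^'d^'d) \<Rightarrow> (real^'d \<Rightarrow> real) \<Rightarrow> real \<Rightarrow> real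
    \<Rightarrow> ((real^'d) set set \<Rightarrow> ((real^'d) set \<Rightarrow> real) \<Rightarrow> real) \<Rightarrow> (real \<Rightarrow> real \<Rightarrow> real)
    \<Rightarrow> 'd::finite mesh \<Rightarrow> real \<Rightarrow> (real^'d \<Rightarrow> real) \<Rightarrow> (nat \<Rightarrow> 'd hybrid) \<Rightarrow> bool" where
  "positive_solution \<Omega> \<Lambda> \<phi> M \<eta> f m D dt u_in u \<longleftrightarrow>
     (\<forall>K\<in>cells D. cval (u 0) K = 1 / volume K * (LINT x:K|lebesgue. u_in x)) \<and>
     (\<forall>n\<ge>1. positive D (u n)) \<and>
     (\<forall>n\<ge>1. \<forall>v.
        1 / dt * (LINT x:\<Omega>|lebesgue. (recon D (u n) x - recon D (u (n - 1)) x) * recon D v x)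
        + scheme_form \<eta> \<Lambda> f m D (u n) (log_ratio (u n) (steady_state \<Omega> \<phi> M)) v = 0)"

definition \<Phi>\<^sub>1 :: "real \<Rightarrow> real" where
  "\<Phi>\<^sub>1 s = (if s = 0 then 1 else s * ln s - s + 1)"

definition entropy ::
  "(real^'d) set \<Rightarrow> 'd::finite mesh \<Rightarrow> 'd hybrid \<Rightarrow> 'd hybrid \<Rightarrow> real" where
  "entropy \<Omega> D u' u =
     (LINT x:\<Omega>|lebesgue. recon D u' x * \<Phi>\<^sub>1 (recon D u x / recon D u' x))"

definition dissipation ::
  "real \<Rightarrow> (real^'d \<Rightarrow> real^'d^'d) \<Rightarrow> ((real^'d) set set \<Rightarrow> ((real^'d) set \<Rightarrow> real) \<Rightarrow> real)
    \<Rightarrow> (real \<Rightarrow> real \<Rightarrow> real) \<Rightarrow> 'd::finite mesh \<Rightarrow> 'd hybrid \<Rightarrow> 'd hybrid \<Rightarrow> real" where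
  "dissipation \<eta> \<Lambda> f m D u' u =
     scheme_form \<eta> \<Lambda> f m D u (log_ratio u u') (log_ratio u u')"

definition dissipation_hat ::
  "real \<Rightarrow> (real^'d \<Rightarrow> real^'d^'d) \<Rightarrow> 'd::finite mesh \<Rightarrow> 'd hybrid \<Rightarrow> 'd hybrid \<Rightarrow> real" where
  "dissipation_hat \<eta> \<Lambda> D u' u = 4 * (\<Sum>K\<in>cells D.
     min (cval u' K) (MIN \<sigma>\<in>faces_of D K. fval u' \<sigma>) *
     local_form \<eta> \<Lambda> D K (sqrt_ratio u u') (sqrt_ratio u u'))"

end

theory Submission
  imports Defs
begin

text \<open>The squared \<open>L\<^sup>1\<close> distance to the steady state is controlled by the entropy, and the entropy is
  dissipated at a rate at least proportional to itself.

  Reconstructions are constant on each cell, so the entropy, the \<open>L\<^sup>1\<close> norm and the time-derivative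
  term of the scheme are finite sums weighted by cell volumes (\<open>integral_piecewise_constant\<close>). Testing the scheme with
  \<open>w\<^sup>n = log (u\<^sup>n / u\<^sup>\<infinity>)\<close> and using that \<open>log\<close> is the derivative of the convex function \<open>\<Phi>\<^sub>1\<close> gives
  \<open>E\<^sup>n\<^sup>+\<^sup>1 + \<Delta>t D\<^sup>n\<^sup>+\<^sup>1 \<le> E\<^sup>n\<close> (\<open>entropy_dissipation_step\<close>). The implicit discretisation is what puts
  the dissipation at the new time, where \<open>u\<close> is positive; the initial datum may vanish on a cell.

  The dissipation controls the entropy through a chain of four inequalities. The constant \<open>C\<^sub>F\<close>
  replaces the logarithms by \<open>\<xi> = sqrt (u / u\<^sup>\<infinity>)\<close>; the steady state is bounded below by
  \<open>M \<omega>\<^sub>b / (|\<Omega>| \<omega>\<^sub>s)\<close> on cells and faces (\<open>steady_state_bounds\<close>); ellipticity of \<open>\<Lambda>\<close> and coercivity of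
  the discrete gradient leave the discrete \<open>H\<^sup>1\<close> seminorm of \<open>\<xi>\<close> (\<open>dissipation_hat_coercive\<close>); and the
  logarithmic Sobolev inequality bounds the entropy by that seminorm. The last inequality requires
  the mass of \<open>u\<^sup>n\<close> to be \<open>M\<close>, which follows from testing the scheme with a constant
  (\<open>positive_solution_mass\<close>). Together, \<open>D\<^sup>n \<ge> \<nu> E\<^sup>n\<close> and hence \<open>(1 + \<nu> \<Delta>t) E\<^sup>n\<^sup>+\<^sup>1 \<le> E\<^sup>n\<close>.

  The \<open>L\<^sup>1\<close> estimate is the Csiszar-Kullback inequality between two densities of the same mass \<open>M\<close>
  (\<open>L1_distance_le_entropy\<close>).\<close>

section \<open>The entropy function and the Csiszar-Kullback inequality\<close>

text \<open>Convexity of \<open>\<Phi>\<^sub>1\<close>, whose derivative is \<open>ln\<close>. The tangent is taken at the positive point \<open>b\<close>, the new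
  time level, so that \<open>a = 0\<close> is covered.\<close>

lemma \<Phi>\<^sub>1_diff_le_tangent:
  assumes "0 \<le> a" "0 < b"
  shows "\<Phi>\<^sub>1 b - \<Phi>\<^sub>1 a \<le> (b - a) * ln b"
proof (cases "a = 0")
  case True
  with assms show ?thesis by (simp add: \<Phi>\<^sub>1_def)
next
  case False
  with assms have a: "a > 0" by simp
  have "a * (ln b - ln a) \<le> a * (b / a - 1)"
    using ln_le_minus_one[of "b / a"] a assms by (simp add: ln_div)
  also have "\<dots> = b - a" using a by (simp add: field_simps)
  finally show ?thesis using a assms by (simp add: \<Phi>\<^sub>1_def algebra_simps)
qed

lemma \<Phi>\<^sub>1_nonneg: "0 \<le> \<Phi>\<^sub>1 s" if "0 < s"
  using \<Phi>\<^sub>1_diff_le_tangent[of s 1] that by (simp add: \<Phi>\<^sub>1_def)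

text \<open>The difference \<open>h\<close> of the two sides has \<open>h 1 = h' 1 = 0\<close> and \<open>h'' s = 4 (ln s + 1 / s - 1) \<ge> 0\<close>, so
  it lies above its horizontal tangent at \<open>1\<close>.\<close>

lemma square_le_\<Phi>\<^sub>1:
  assumes "0 < s"
  shows "3 * (s - 1)\<^sup>2 \<le> (2 * s + 4) * \<Phi>\<^sub>1 s"
proof -
  define h where "h = (\<lambda>s::real. (2 * s + 4) * (s * ln s - s + 1) - 3 * (s - 1)\<^sup>2)"
  define h' where "h' = (\<lambda>s::real. 4 * ((s + 1) * ln s - 2 * (s - 1)))"
  define h'' where "h'' = (\<lambda>s::real. 4 * (ln s + 1 / s - 1))"
  have d1: "(h has_real_derivative h' x) (at x)" if "x \<in> {0<..}" for x
    unfolding h_def h'_def using that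
    by (auto intro!: derivative_eq_intros simp: field_simps power2_eq_square)
  have d2: "(h' has_real_derivative h'' x) (at x)" if "x \<in> {0<..}" for x
    unfolding h'_def h''_def using that
    by (auto intro!: derivative_eq_intros simp: field_simps)
  have nonneg: "0 \<le> h'' x" if "x \<in> {0<..}" for x
    using ln_le_minus_one[of "1 / x"] that by (simp add: h''_def ln_div)
  have "convex_on {0<..} h"
    by (rule f''_ge0_imp_convex[OF _ d1 d2 nonneg]) auto
  then have "h s - h 1 \<ge> h' 1 * (s - 1)"
    using assms
    by (intro convex_on_imp_above_tangent[where A = "{0<..}"])
       (auto intro!: has_field_derivative_at_within[OF d1] simp: interior_open)
  then show ?thesis
    using assms by (simp add: h_def h'_def \<Phi>\<^sub>1_def)
qed

text \<open>Taking square roots in \<open>square_le_\<Phi>\<^sub>1\<close> at \<open>s = p / q\<close> bounds \<open>|p - q|\<close> by a product of two factors. By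
  Cauchy-Schwarz the sum of the squares of the first factor is \<open>(2 M + 4 M) / 3 = 2 M\<close>, which gives
  the optimal constant.\<close>

lemma csiszar_kullback_sum:
  fixes p q :: "'a \<Rightarrow> real"
  assumes pos: "\<And>i. i \<in> S \<Longrightarrow> p i > 0" "\<And>i. i \<in> S \<Longrightarrow> q i > 0"
    and mass: "sum p S = M" "sum q S = M"
  shows "(\<Sum>i\<in>S. \<bar>p i - q i\<bar>)\<^sup>2 \<le> 2 * M * (\<Sum>i\<in>S. q i * \<Phi>\<^sub>1 (p i / q i))"
proof -
  define a where "a i = sqrt ((2 * p i + 4 * q i) / 3)" for i
  define b where "b i = sqrt (q i * \<Phi>\<^sub>1 (p i / q i))" for i
  have a2: "(a i)\<^sup>2 = (2 * p i + 4 * q i) / 3" if "i \<in> S" for i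
    using pos[OF that] by (simp add: a_def)
  have b2: "(b i)\<^sup>2 = q i * \<Phi>\<^sub>1 (p i / q i)" if "i \<in> S" for i
    using pos[OF that] by (simp add: b_def \<Phi>\<^sub>1_nonneg)
  have "\<bar>p i - q i\<bar> \<le> a i * b i" if "i \<in> S" for i
  proof (rule power2_le_imp_le)
    let ?s = "p i / q i"
    have q: "q i > 0" using pos that by simp
    have "(p i - q i)\<^sup>2 = (q i)\<^sup>2 * (?s - 1)\<^sup>2"
      using q by (simp add: field_simps power2_eq_square)
    also have "\<dots> \<le> (q i)\<^sup>2 * ((2 * ?s + 4) / 3 * \<Phi>\<^sub>1 ?s)"
      using square_le_\<Phi>\<^sub>1[of ?s] pos[OF that] by (intro mult_left_mono) auto
    also have "\<dots> = (a i)\<^sup>2 * (b i)\<^sup>2"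
      using q unfolding a2[OF that] b2[OF that] by (simp add: field_simps power2_eq_square)
    finally show "\<bar>p i - q i\<bar>\<^sup>2 \<le> (a i * b i)\<^sup>2" by (simp add: power_mult_distrib)
    show "0 \<le> a i * b i"
      using pos[OF that] by (simp add: a_def b_def \<Phi>\<^sub>1_nonneg)
  qed
  then have "(\<Sum>i\<in>S. \<bar>p i - q i\<bar>)\<^sup>2 \<le> (\<Sum>i\<in>S. a i * b i)\<^sup>2"
    by (intro power_mono sum_mono sum_nonneg) auto
  also have "\<dots> \<le> (\<Sum>i\<in>S. (a i)\<^sup>2) * (\<Sum>i\<in>S. (b i)\<^sup>2)"
    by (rule Cauchy_Schwarz_ineq_sum)
  also have "(\<Sum>i\<in>S. (a i)\<^sup>2) = (2 * sum p S + 4 * sum q S) / 3"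
    by (simp add: a2 sum_divide_distrib[symmetric] sum.distrib sum_distrib_left)
  also have "\<dots> = 2 * M" by (simp add: mass)
  also have "(\<Sum>i\<in>S. (b i)\<^sup>2) = (\<Sum>i\<in>S. q i * \<Phi>\<^sub>1 (p i / q i))"
    by (simp add: b2)
  finally show ?thesis .
qed

section \<open>Integration over the mesh\<close>

text \<open>A convex set is negligible as soon as its interior is empty, and a polytope of dimension less than
  that of the space has empty interior.\<close>

lemma negligible_frontier_polytopal:
  assumes "polytopal (S :: (real^'d) set)"
  shows "negligible (frontier S)"
proof -
  obtain \<F> where F: "finite \<F>" "frontier S = \<Union>\<F>"
    and P: "\<And>P. P \<in> \<F> \<Longrightarrow> polytope P \<and> aff_dim P = int CARD('d) - 1"
    using assms unfolding polytopal_def by blast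
  have "negligible P" if "P \<in> \<F>" for P
  proof -
    have "aff_dim P \<noteq> int DIM(real^'d)" using P[OF that] by simp
    then have "interior P = {}" using aff_dim_nonempty_interior by blast
    then show ?thesis
      using P[OF that] polytope_imp_convex negligible_convex_interior by blast
  qed
  then show ?thesis using F by (simp add: negligible_Union)
qed

lemma discretisation_cellD:
  assumes "discretisation \<Omega> D" "bounded \<Omega>" "K \<in> cells D"
  shows "K \<subseteq> \<Omega>" "open K" "K \<in> lmeasurable" "volume K > 0" "polytopal K"
    "K \<noteq> {}"
proof -
  have "\<forall>K\<in>cells D. K \<noteq> {} \<and> K \<subseteq> \<Omega> \<and> open K \<and> connected K \<and> polytopal K \<and> volume K > 0"
    using assms(1) unfolding discretisation_def by (elim conjE) assumption
  with assms(3) show *: "K \<subseteq> \<Omega>" "open K" "volume K > 0" "polytopal K" "K \<noteq> {}"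
    by blast+
  show "K \<in> lmeasurable"
    using * assms(2) bounded_subset lmeasurable_open by blast
qed

lemma discretisation_meshD:
  assumes "discretisation \<Omega> D"
  shows "finite (cells D)" "disjoint (cells D)" "finite (faces D)"
    "K \<in> cells D \<Longrightarrow> faces_of D K \<subseteq> faces D"
    "K \<in> cells D \<Longrightarrow> finite (faces_of D K)"
    "K \<in> cells D \<Longrightarrow> frontier K = (\<Union>\<sigma>\<in>faces_of D K. closure \<sigma>)"
    "closure \<Omega> = (\<Union>K\<in>cells D. closure K)"
proof -
  show fin: "finite (cells D)" "disjoint (cells D)" "finite (faces D)"
    and "closure \<Omega> = (\<Union>K\<in>cells D. closure K)"
    using assms unfolding discretisation_def by simp_all
  have "\<forall>K\<in>cells D. faces_of D K \<subseteq> faces D \<and> frontier K = (\<Union>\<sigma>\<in>faces_of D K. closure \<sigma>)"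
    using assms unfolding discretisation_def by (elim conjE) assumption
  then show "K \<in> cells D \<Longrightarrow> faces_of D K \<subseteq> faces D"
    "K \<in> cells D \<Longrightarrow> finite (faces_of D K)"
    "K \<in> cells D \<Longrightarrow> frontier K = (\<Union>\<sigma>\<in>faces_of D K. closure \<sigma>)"
    using finite_subset[OF _ fin(3)] by blast+
qed

lemma discretisation_faceD:
  assumes "discretisation \<Omega> D" "\<sigma> \<in> faces D"
  shows "\<sigma> \<subseteq> closure \<Omega>" "area \<sigma> > 0" "\<exists>H. is_hyperplane H \<and> openin (top_of_set H) \<sigma>"
proof -
  have "\<forall>\<sigma>\<in>faces D. \<sigma> \<noteq> {} \<and> \<sigma> \<subseteq> closure \<Omega> \<and> connected \<sigma> \<and>
        (\<exists>H. is_hyperplane H \<and> openin (top_of_set H) \<sigma>) \<and> area \<sigma> > 0"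
    using assms unfolding discretisation_def by (elim conjE) assumption
  with assms(2) show "\<sigma> \<subseteq> closure \<Omega>" "area \<sigma> > 0"
    "\<exists>H. is_hyperplane H \<and> openin (top_of_set H) \<sigma>" by simp_all
qed

lemma recon_on_cell:
  assumes "discretisation \<Omega> D" "K \<in> cells D" "x \<in> K"
  shows "recon D v x = cval v K"
proof -
  have "indicator L x = (if L = K then 1 else 0 :: real)" if "L \<in> cells D" for L
    using discretisation_meshD(2)[OF assms(1)] assms that
    by (auto simp: disjoint_def indicator_def)
  then have "recon D v x = (\<Sum>L\<in>cells D. if L = K then cval v K else 0)"
    unfolding recon_def by (intro sum.cong) auto
  then show ?thesis
    using assms discretisation_meshD(1)[OF assms(1)] by simp
qed

lemma recon_off_cells: "x \<notin> \<Union>(cells D) \<Longrightarrow> recon D v x = 0"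
  unfolding recon_def by (intro sum.neutral) auto

text \<open>Stated for an arbitrary function that is constant on each cell, rather than for reconstructions
  only, because it is applied to nonlinear expressions in several reconstructions; these still
  vanish off the cells.\<close>

lemma integral_piecewise_constant:
  assumes mesh: "discretisation \<Omega> D" and bdd: "bounded \<Omega>"
    and on: "\<And>K x. K \<in> cells D \<Longrightarrow> x \<in> K \<Longrightarrow> g x = c K"
    and off: "\<And>x. x \<notin> \<Union>(cells D) \<Longrightarrow> g x = (0::real)"
  shows "(LINT x:\<Omega>|lebesgue. g x) = (\<Sum>K\<in>cells D. volume K * c K)"
proof -
  have "indicator \<Omega> x *\<^sub>R g x = (\<Sum>K\<in>cells D. indicator K x * c K)" for x
  proof (cases "x \<in> \<Union>(cells D)")
    case True
    then obtain K where K: "K \<in> cells D" "x \<in> K" by blast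
    then have "x \<in> \<Omega>" using discretisation_cellD(1)[OF mesh bdd] by blast
    then show ?thesis
      using on[OF K] recon_on_cell[OF mesh K, of "\<lparr>cval = c, fval = c\<rparr>"]
      by (simp add: recon_def mult.commute)
  next
    case False
    then have "(\<Sum>K\<in>cells D. indicator K x * c K) = 0"
      by (intro sum.neutral) auto
    with False show ?thesis using off by simp
  qed
  then have "(LINT x:\<Omega>|lebesgue. g x) = (LINT x|lebesgue. (\<Sum>K\<in>cells D. indicator K x * c K))"
    unfolding set_lebesgue_integral_def by presburger
  also have "\<dots> = (\<Sum>K\<in>cells D. LINT x|lebesgue. indicator K x * c K)"
    using discretisation_cellD(3)[OF mesh bdd]
    by (intro Bochner_Integration.integral_sum) (auto simp: lmeasurable_iff_integrable)
  also have "\<dots> = (\<Sum>K\<in>cells D. volume K * c K)"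
    by simp
  finally show ?thesis .
qed

text \<open>The part of \<open>\<Omega>\<close> outside the cells is covered by the boundaries of the cells.\<close>

lemma negligible_off_cells:
  assumes mesh: "discretisation \<Omega> D" and "bounded \<Omega>"
  shows "negligible (\<Omega> - \<Union>(cells D))"
proof (rule negligible_subset)
  show "negligible (\<Union>K\<in>cells D. frontier K)"
    using discretisation_meshD(1)[OF mesh] discretisation_cellD(5)[OF assms]
    by (intro negligible_Union) (auto intro: negligible_frontier_polytopal)
  have sub: "\<Omega> \<subseteq> (\<Union>K\<in>cells D. closure K)"
    using discretisation_meshD(7)[OF mesh] closure_subset by blast
  show "\<Omega> - \<Union>(cells D) \<subseteq> (\<Union>K\<in>cells D. frontier K)"
  proof
    fix x assume x: "x \<in> \<Omega> - \<Union>(cells D)"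
    with sub obtain K where K: "K \<in> cells D" "x \<in> closure K" by blast
    with x have "x \<notin> interior K" using interior_subset[of K] by blast
    with K show "x \<in> (\<Union>K\<in>cells D. frontier K)" by (auto simp: frontier_def)
  qed
qed

lemma integral_eq_sum_cells:
  fixes g :: "real^'d \<Rightarrow> real"
  assumes mesh: "discretisation \<Omega> D" and bdd: "bounded \<Omega>"
    and g: "set_integrable lebesgue \<Omega> g"
  shows "(LINT x:\<Omega>|lebesgue. g x) = (\<Sum>K\<in>cells D. LINT x:K|lebesgue. g x)"
proof -
  let ?U = "\<Union>(cells D)"
  note cell = discretisation_cellD[OF mesh bdd]
  have sub: "?U \<subseteq> \<Omega>" using cell(1) by blast
  have U: "?U \<in> sets lebesgue"
    using open_Union[of "cells D"] cell(2) bounded_subset[OF bdd sub]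
    by (intro fmeasurableD lmeasurable_open) auto
  have ae: "AE x in lebesgue. x \<in> ?U \<longleftrightarrow> x \<in> \<Omega>"
    by (rule AE_I'[of "\<Omega> - ?U"])
       (use negligible_off_cells[OF mesh bdd] sub in \<open>auto simp: negligible_iff_null_sets\<close>)
  have "(LINT x:\<Omega>|lebesgue. g x) = (LINT x:?U|lebesgue. g x)"
    using g set_integrable_subset[OF g U sub] ae
    by (intro set_integral_cong_set) (auto simp: set_borel_measurable_def set_integrable_def)
  also have "\<dots> = (\<Sum>K\<in>cells D. LINT x:K|lebesgue. g x)"
  proof -
    have meas: "K \<in> sets lebesgue" if "K \<in> cells D" for K
      using cell(3)[OF that] by (rule fmeasurableD)
    have "set_integrable lebesgue K g" if "K \<in> cells D" for K
      using set_integrable_subset[OF g meas[OF that] cell(1)[OF that]] .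
    moreover have "disjoint_family_on (\<lambda>K. K) (cells D)"
      using discretisation_meshD(2)[OF mesh] by (simp add: disjoint_family_on_def disjoint_def)
    ultimately show ?thesis
      using set_integral_finite_Union[of "cells D" "\<lambda>K. K" lebesgue g, OF discretisation_meshD(1)[OF mesh]]
        meas by simp
  qed
  finally show ?thesis .
qed

section \<open>Bounded functions on sets of finite measure\<close>

lemma set_integrable_if_AE_bounded:
  fixes f :: "'a \<Rightarrow> real"
  assumes A: "A \<in> sets M" "emeasure M A < \<infinity>"
    and meas: "f \<in> borel_measurable (restrict_space M A)"
    and bound: "AE x in M. x \<in> A \<longrightarrow> \<bar>f x\<bar> \<le> B"
  shows "set_integrable M A f"
proof (rule set_integrable_bound)
  show "set_integrable M A (\<lambda>_. B)"
    using A by (simp add: set_integrable_def)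
  show "set_borel_measurable M A f"
    using meas A(1) by (simp add: set_borel_measurable_def borel_measurable_restrict_space_iff)
  show "AE x in M. x \<in> A \<longrightarrow> norm (f x) \<le> norm B"
    using bound by eventually_elim auto
qed

lemma set_integral_between:
  fixes f :: "'a \<Rightarrow> real"
  assumes A: "A \<in> sets M" "measure M A > 0"
    and meas: "f \<in> borel_measurable (restrict_space M A)"
    and bounds: "\<And>x. x \<in> A \<Longrightarrow> a \<le> f x \<and> f x \<le> b"
  shows "set_integrable M A f"
    and "a * measure M A \<le> (LINT x:A|M. f x)" "(LINT x:A|M. f x) \<le> b * measure M A"
proof -
  \<comment> \<open>A set of infinite measure has real-valued measure \<open>0\<close>.\<close>
  have fin: "emeasure M A < \<infinity>"
    using A(2) by (metis enn2real_top infinity_ennreal_def less_irrefl measure_def top.not_eq_extremum)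
  have "\<bar>f x\<bar> \<le> max \<bar>a\<bar> \<bar>b\<bar>" if "x \<in> A" for x
    using bounds[OF that] by linarith
  then show f: "set_integrable M A f"
    by (intro set_integrable_if_AE_bounded[OF A(1) fin meas]) auto
  have const: "set_integrable M A (\<lambda>_. c)" "(LINT x:A|M. c) = c * measure M A" for c :: real
    using A(1) fin by (simp_all add: set_integrable_def set_lebesgue_integral_def)
  show "a * measure M A \<le> (LINT x:A|M. f x)"
    using set_integral_mono[OF const(1)[of a] f] bounds const(2)[of a] by simp
  show "(LINT x:A|M. f x) \<le> b * measure M A"
    using set_integral_mono[OF f const(1)[of b]] bounds const(2)[of b] by simp
qed

section \<open>Faces and pyramids\<close>

lemma face_relatively_open:
  assumes "discretisation \<Omega> D" "\<sigma> \<in> faces D"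
  obtains H T where "closed H" "open T" "\<sigma> = H \<inter> T"
  using discretisation_faceD(3)[OF assms] that closed_hyperplane
  unfolding is_hyperplane_def openin_open by metis

lemma face_borel:
  assumes "discretisation \<Omega> D" "\<sigma> \<in> faces D"
  shows "\<sigma> \<in> sets borel"
  using face_relatively_open[OF assms] by (metis borel_closed borel_open sets.Int)

lemma sets_face_measure: "sets (face_measure \<sigma>) = sets borel"
  by (simp add: face_measure_def hyperplane_measure_def)

text \<open>The pyramid is the image of \<open>(0,1) \<times> \<sigma>\<close> under a continuous map. A face is an open subset of a closed
  set, so this product is a countable union of compact sets, and so is its image.\<close>

lemma pyramid_borel:
  assumes "discretisation \<Omega> D" "\<sigma> \<in> faces D"
  shows "pyramid D K \<sigma> \<in> sets borel"
proof -
  obtain H T where HT: "closed H" "open T" "\<sigma> = H \<inter> T"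
    by (rule face_relatively_open[OF assms])
  define g where "g = (\<lambda>(t::real, y). (1 - t) *\<^sub>R center D K + t *\<^sub>R y)"
  have g: "continuous_on A g" for A
    unfolding g_def case_prod_unfold by (intro continuous_intros)
  have "open ({0<..<1::real} \<times> T)" using HT by (simp add: open_Times)
  then obtain C :: "nat \<Rightarrow> (real \<times> (real^'a)) set"
    where C: "\<And>n. compact (C n)" "(\<Union>n. C n) = {0<..<1} \<times> T"
    by (metis open_Union_compact_subsets)
  have "pyramid D K \<sigma> = g ` ({0<..<1} \<times> \<sigma>)"
    by (force simp: pyramid_def g_def)
  also have "{0<..<1} \<times> \<sigma> = (\<Union>n. C n \<inter> (UNIV \<times> H))"
    using C(2) HT(3) by auto
  also have "g ` \<dots> = (\<Union>n. g ` (C n \<inter> (UNIV \<times> H)))"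
    by blast
  also have "\<dots> \<in> sets borel"
  proof (intro sets.countable_UN image_subsetI)
    fix n
    have "compact (C n \<inter> (UNIV \<times> H))"
      using C(1) HT(1) by (intro compact_Int_closed) (auto intro: closed_Times)
    then show "g ` (C n \<inter> (UNIV \<times> H)) \<in> sets borel"
      by (intro borel_closed compact_imp_closed compact_continuous_image g)
  qed
  finally show ?thesis .
qed

text \<open>Without faces a cell would have empty boundary, hence be the whole space. The minimum over the faces
  in the definition of \<open>dissipation_hat\<close> is meaningful for this reason.\<close>

lemma faces_of_nonempty:
  assumes "discretisation \<Omega> D" "bounded \<Omega>" "K \<in> cells D"
  shows "faces_of D K \<noteq> {}"
proof
  assume "faces_of D K = {}"
  then have "frontier K = {}"
    using discretisation_meshD(6)[OF assms(1,3)] by simp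
  then have "K = UNIV"
    using discretisation_cellD(6)[OF assms] by (simp add: frontier_eq_empty)
  then show False
    using bounded_subset[OF assms(2) discretisation_cellD(1)[OF assms]] by simp
qed

section \<open>The discrete steady state\<close>

text \<open>Cell and face values are \<open>M / \<integral>\<omega>\<close> times a mean of \<open>\<omega>\<close>. The mean is at least \<open>\<omega>\<^sub>b\<close>, and \<open>\<integral>\<omega>\<close> is at most
  \<open>\<omega>\<^sub>s |\<Omega>|\<close>. The total mass is \<open>M\<close> because the integrals of \<open>\<omega>\<close> over the cells add up to the integral
  over \<open>\<Omega>\<close>.\<close>

lemma steady_state_bounds:
  fixes \<Omega> :: "(real^'d) set"
  assumes mesh: "discretisation \<Omega> D" and dom: "open \<Omega>" "bounded \<Omega>" "volume \<Omega> > 0"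
    and cont: "continuous_on (closure \<Omega>) \<phi>"
    and wb: "0 < \<omega>\<^sub>b" "\<forall>x\<in>closure \<Omega>. \<omega>\<^sub>b \<le> weight \<phi> x \<and> weight \<phi> x \<le> \<omega>\<^sub>s"
    and M: "0 < M"
  defines "b \<equiv> M * \<omega>\<^sub>b / (volume \<Omega> * \<omega>\<^sub>s)"
  shows "K \<in> cells D \<Longrightarrow> b \<le> cval (steady_state \<Omega> \<phi> M) K"
    and "\<sigma> \<in> faces D \<Longrightarrow> b \<le> fval (steady_state \<Omega> \<phi> M) \<sigma>"
    and "(\<Sum>K\<in>cells D. volume K * cval (steady_state \<Omega> \<phi> M) K) = M"
proof -
  define W where "W = (LINT x:\<Omega>|lebesgue. weight \<phi> x)"
  have cw: "continuous_on A (weight \<phi>)" if "A \<subseteq> closure \<Omega>" for A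
    unfolding weight_def using continuous_on_subset[OF cont that] by (intro continuous_intros)
  have leb: "\<omega>\<^sub>b * volume A \<le> (LINT x:A|lebesgue. weight \<phi> x)
      \<and> (LINT x:A|lebesgue. weight \<phi> x) \<le> \<omega>\<^sub>s * volume A \<and> set_integrable lebesgue A (weight \<phi>)"
    if "A \<subseteq> \<Omega>" "A \<in> lmeasurable" "volume A > 0" for A
  proof -
    have sub: "A \<subseteq> closure \<Omega>" using that closure_subset by blast
    have "weight \<phi> \<in> borel_measurable (lebesgue_on A)"
      using cw[OF sub] that by (intro continuous_imp_measurable_on_sets_lebesgue) auto
    with that sub wb(2) show ?thesis
      using set_integral_between[of A lebesgue "weight \<phi>" \<omega>\<^sub>b \<omega>\<^sub>s] by blast
  qed
  have W: "\<omega>\<^sub>b * volume \<Omega> \<le> W" "W \<le> \<omega>\<^sub>s * volume \<Omega>" "set_integrable lebesgue \<Omega> (weight \<phi>)"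
    using leb[of \<Omega>] dom lmeasurable_open unfolding W_def by auto
  have Wpos: "W > 0" using W(1) wb(1) dom(3) by (metis less_le_trans mult_pos_pos)
  have "M / (\<omega>\<^sub>s * volume \<Omega>) \<le> M / W"
    using W(2) Wpos M by (intro divide_left_mono) auto
  then have b: "b \<le> M / W * \<omega>\<^sub>b"
    using wb(1) unfolding b_def by (metis less_imp_le mult.commute mult_right_mono times_divide_eq_left)
  have avg: "b \<le> M / W * (1 / a * I)" if "0 < a" "\<omega>\<^sub>b * a \<le> I" for a I
  proof -
    have "\<omega>\<^sub>b \<le> 1 / a * I" using that by (simp add: field_simps)
    then have "M / W * \<omega>\<^sub>b \<le> M / W * (1 / a * I)"
      using M Wpos by (intro mult_left_mono) auto
    with b show ?thesis by linarith
  qed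
  note cell = discretisation_cellD[OF mesh dom(2)]
  show "b \<le> cval (steady_state \<Omega> \<phi> M) K" if "K \<in> cells D"
    using avg[of "volume K"] leb[of K] cell[OF that]
    by (simp add: steady_state_def Let_def W_def)
  show "b \<le> fval (steady_state \<Omega> \<phi> M) \<sigma>" if s: "\<sigma> \<in> faces D"
  proof -
    note face = discretisation_faceD[OF mesh s]
    have meas: "\<sigma> \<in> sets (face_measure \<sigma>)"
      by (simp add: sets_face_measure face_borel[OF mesh s])
    have "weight \<phi> \<in> borel_measurable (restrict_space borel \<sigma>)"
      by (intro borel_measurable_continuous_on_restrict cw face)
    then have "weight \<phi> \<in> borel_measurable (restrict_space (face_measure \<sigma>) \<sigma>)"
      by (simp cong: measurable_cong_sets sets_restrict_space_cong add: sets_face_measure)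
    then have "\<omega>\<^sub>b * area \<sigma> \<le> (LINT x:\<sigma>|face_measure \<sigma>. weight \<phi> x)"
      using set_integral_between(2)[OF meas, of "weight \<phi>" \<omega>\<^sub>b \<omega>\<^sub>s] face wb(2)
      unfolding area_def by blast
    with face(2) show ?thesis
      using avg[of "area \<sigma>"] by (simp add: steady_state_def Let_def W_def)
  qed
  have "(\<Sum>K\<in>cells D. volume K * cval (steady_state \<Omega> \<phi> M) K)
      = (\<Sum>K\<in>cells D. M / W * (LINT x:K|lebesgue. weight \<phi> x))"
  proof (intro sum.cong refl)
    fix K assume "K \<in> cells D"
    then have "volume K \<noteq> 0" using cell(4) by force
    then show "volume K * cval (steady_state \<Omega> \<phi> M) K = M / W * (LINT x:K|lebesgue. weight \<phi> x)"
      by (simp add: steady_state_def Let_def W_def)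
  qed
  also have "\<dots> = M / W * W"
    using integral_eq_sum_cells[OF mesh dom(2) W(3)]
    by (simp add: W_def sum_distrib_left)
  finally show "(\<Sum>K\<in>cells D. volume K * cval (steady_state \<Omega> \<phi> M) K) = M"
    using Wpos by simp
qed

section \<open>Coercivity of the dissipation\<close>

text \<open>Ellipticity of \<open>\<Lambda>\<close> integrated over the cell. Comparing the two integrals requires the integrands to
  be integrable: the discrete gradient takes finitely many values on Borel sets, and \<open>\<Lambda>\<close> is
  measurable and bounded.\<close>

lemma local_form_coercive:
  fixes \<Omega> :: "(real^'d) set" and \<Lambda> :: "real^'d \<Rightarrow> real^'d^'d"
  assumes mesh: "discretisation \<Omega> D" and dom: "open \<Omega>" "bounded \<Omega>" and K: "K \<in> cells D"
    and tensor: "diffusion_tensor \<Omega> \<Lambda> l\<^sub>b l\<^sub>s"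
  shows "l\<^sub>b * (LINT x:K|lebesgue. (norm (discrete_grad \<eta> D K v x))\<^sup>2) \<le> local_form \<eta> \<Lambda> D K v v"
proof -
  note cell = discretisation_cellD[OF mesh dom(2) K]
  have Kleb: "K \<in> sets lebesgue" "emeasure lebesgue K < \<infinity>"
    using cell(3) by (auto simp: fmeasurable_def)
  define c where "c \<sigma> = avg_grad D K v +
         (\<eta> / face_dist D K \<sigma> *
            (fval v \<sigma> - cval v K - avg_grad D K v \<bullet> (barycentre \<sigma> - center D K)))
         *\<^sub>R outward_normal K \<sigma>" for \<sigma>
  define g where "g = discrete_grad \<eta> D K v"
  define B where "B = (\<Sum>\<sigma>\<in>faces_of D K. norm (c \<sigma>))"
  have g_eq: "g = (\<lambda>x. \<Sum>\<sigma>\<in>faces_of D K. indicator (pyramid D K \<sigma>) x *\<^sub>R c \<sigma>)"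
    by (simp add: g_def discrete_grad_def c_def fun_eq_iff)
  have gB: "norm (g x) \<le> B" for x
    unfolding g_eq B_def by (intro sum_norm_le) (simp add: indicator_def)
  have "g \<in> borel_measurable borel"
    unfolding g_eq using pyramid_borel[OF mesh] discretisation_meshD(4)[OF mesh K]
    by (intro borel_measurable_sum borel_measurable_scaleR borel_measurable_indicator) auto
  then have "g \<in> borel_measurable lebesgue"
    by (intro measurable_completion) simp
  then have g: "g \<in> borel_measurable (lebesgue_on K)"
    by (rule measurable_restrict_space1)
  have "\<Lambda> \<in> borel_measurable (lebesgue_on \<Omega>)"
    using tensor by (simp add: diffusion_tensor_def)
  then have \<Lambda>: "\<Lambda> \<in> borel_measurable (lebesgue_on K)"
    using cell(1) by (rule measurable_restrict_mono)
  have pair: "(\<lambda>x. (\<Lambda> x, g x)) \<in> borel_measurable (lebesgue_on K)"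
    using \<Lambda> g by (rule borel_measurable_Pair)
  have cont: "continuous_on UNIV (\<lambda>p :: (real^'d^'d) \<times> (real^'d). (fst p *v snd p) \<bullet> snd p)"
    unfolding matrix_vector_mult_def by (intro continuous_intros)
  have form: "(\<lambda>x. (\<Lambda> x *v g x) \<bullet> g x) \<in> borel_measurable (lebesgue_on K)"
    using borel_measurable_continuous_on[OF cont pair] by simp
  have l: "0 < l\<^sub>b" using tensor by (simp add: diffusion_tensor_def)
  have "AE x in lebesgue. x \<in> \<Omega> \<longrightarrow>
        (\<forall>\<xi>. l\<^sub>b * (norm \<xi>)\<^sup>2 \<le> \<xi> \<bullet> (\<Lambda> x *v \<xi>) \<and> norm (\<Lambda> x *v \<xi>) \<le> l\<^sub>s * norm \<xi>)"
    using tensor dom lmeasurable_open[of \<Omega>] unfolding diffusion_tensor_def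
    by (subst (asm) AE_restrict_space_iff) (auto elim: eventually_mono)
  then have ell: "AE x in lebesgue. x \<in> K \<longrightarrow>
        (\<forall>\<xi>. l\<^sub>b * (norm \<xi>)\<^sup>2 \<le> \<xi> \<bullet> (\<Lambda> x *v \<xi>) \<and> norm (\<Lambda> x *v \<xi>) \<le> l\<^sub>s * norm \<xi>)"
    using cell(1) by (auto elim: eventually_mono)
  have l': "0 \<le> l\<^sub>s" using tensor by (simp add: diffusion_tensor_def)
  have int_form: "set_integrable lebesgue K (\<lambda>x. (\<Lambda> x *v g x) \<bullet> g x)"
  proof (rule set_integrable_if_AE_bounded[OF Kleb form])
    show "AE x in lebesgue. x \<in> K \<longrightarrow> \<bar>(\<Lambda> x *v g x) \<bullet> g x\<bar> \<le> (l\<^sub>s * B) * B"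
      using ell
    proof eventually_elim
      case (elim x)
      show ?case
      proof
        assume "x \<in> K"
        then have "norm (\<Lambda> x *v g x) \<le> l\<^sub>s * norm (g x)" using elim by blast
        also have "\<dots> \<le> l\<^sub>s * B" using gB l' by (intro mult_left_mono)
        finally have "norm (\<Lambda> x *v g x) * norm (g x) \<le> (l\<^sub>s * B) * B"
          using gB[of x] by (intro mult_mono) (auto intro: order_trans[OF norm_ge_zero])
        then show "\<bar>(\<Lambda> x *v g x) \<bullet> g x\<bar> \<le> (l\<^sub>s * B) * B"
          using Cauchy_Schwarz_ineq2 order_trans by blast
      qed
    qed
  qed
  have int_norm: "set_integrable lebesgue K (\<lambda>x. l\<^sub>b * (norm (g x))\<^sup>2)"
  proof (rule set_integrable_if_AE_bounded[OF Kleb])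
    show "(\<lambda>x. l\<^sub>b * (norm (g x))\<^sup>2) \<in> borel_measurable (lebesgue_on K)"
      using g by measurable
    show "AE x in lebesgue. x \<in> K \<longrightarrow> \<bar>l\<^sub>b * (norm (g x))\<^sup>2\<bar> \<le> l\<^sub>b * B\<^sup>2"
      using l gB by (intro AE_I2) (simp add: abs_mult power_mono)
  qed
  have "l\<^sub>b * (LINT x:K|lebesgue. (norm (g x))\<^sup>2) = (LINT x:K|lebesgue. l\<^sub>b * (norm (g x))\<^sup>2)"
    by simp
  also have "\<dots> \<le> (LINT x:K|lebesgue. (\<Lambda> x *v g x) \<bullet> g x)"
    using ell
    by (intro set_integral_mono_AE[OF int_norm int_form]) (auto elim!: eventually_mono simp: inner_commute)
  finally show ?thesis
    by (simp add: local_form_def g_def)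
qed

text \<open>The local weight in \<open>dissipation_hat\<close> is at least \<open>b\<close>, and replacing it by \<open>b\<close> decreases each term
  because the local forms are nonnegative by \<open>local_form_coercive\<close>.\<close>

lemma dissipation_hat_coercive:
  fixes \<Omega> :: "(real^'d) set"
  assumes mesh: "discretisation \<Omega> D" and dom: "open \<Omega>" "bounded \<Omega>"
    and tensor: "diffusion_tensor \<Omega> \<Lambda> l\<^sub>b l\<^sub>s"
    and lower: "0 \<le> b" "\<And>K. K \<in> cells D \<Longrightarrow> b \<le> cval u' K" "\<And>\<sigma>. \<sigma> \<in> faces D \<Longrightarrow> b \<le> fval u' \<sigma>"
    and coercive: "\<And>K v. K \<in> cells D \<Longrightarrow>
      a * local_seminorm_sq D K v \<le> (LINT x:K|lebesgue. (norm (discrete_grad \<eta> D K v x))\<^sup>2)"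
  shows "4 * b * l\<^sub>b * a * seminorm_sq D (sqrt_ratio u u') \<le> dissipation_hat \<eta> \<Lambda> D u' u"
proof -
  let ?\<xi> = "sqrt_ratio u u'"
  have l: "0 \<le> l\<^sub>b" using tensor by (simp add: diffusion_tensor_def)
  have "b * l\<^sub>b * a * local_seminorm_sq D K ?\<xi>
      \<le> min (cval u' K) (MIN \<sigma>\<in>faces_of D K. fval u' \<sigma>) * local_form \<eta> \<Lambda> D K ?\<xi> ?\<xi>"
    if K: "K \<in> cells D" for K
  proof -
    let ?G = "LINT x:K|lebesgue. (norm (discrete_grad \<eta> D K ?\<xi> x))\<^sup>2"
    have form: "l\<^sub>b * ?G \<le> local_form \<eta> \<Lambda> D K ?\<xi> ?\<xi>"
      by (rule local_form_coercive[OF mesh dom K tensor])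
    have "0 \<le> ?G"
      unfolding set_lebesgue_integral_def by (intro Bochner_Integration.integral_nonneg) simp
    with l form have nonneg: "0 \<le> local_form \<eta> \<Lambda> D K ?\<xi> ?\<xi>"
      by (metis mult_nonneg_nonneg order_trans)
    have "b * l\<^sub>b * a * local_seminorm_sq D K ?\<xi> = b * (l\<^sub>b * (a * local_seminorm_sq D K ?\<xi>))"
      by simp
    also have "\<dots> \<le> b * (l\<^sub>b * ?G)"
      using lower(1) l coercive[OF K] by (intro mult_left_mono)
    also have "\<dots> \<le> b * local_form \<eta> \<Lambda> D K ?\<xi> ?\<xi>"
      using lower(1) form by (rule mult_left_mono[rotated])
    also have "\<dots> \<le> min (cval u' K) (MIN \<sigma>\<in>faces_of D K. fval u' \<sigma>) * local_form \<eta> \<Lambda> D K ?\<xi> ?\<xi>"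
    proof (rule mult_right_mono[OF _ nonneg])
      have "b \<le> (MIN \<sigma>\<in>faces_of D K. fval u' \<sigma>)"
        using discretisation_meshD(4,5)[OF mesh K] faces_of_nonempty[OF mesh dom(2) K] lower(3)
        by (subst Min_ge_iff) auto
      with lower(2)[OF K] show "b \<le> min (cval u' K) (MIN \<sigma>\<in>faces_of D K. fval u' \<sigma>)" by simp
    qed
    finally show ?thesis .
  qed
  then have "(\<Sum>K\<in>cells D. b * l\<^sub>b * a * local_seminorm_sq D K ?\<xi>)
      \<le> (\<Sum>K\<in>cells D. min (cval u' K) (MIN \<sigma>\<in>faces_of D K. fval u' \<sigma>) * local_form \<eta> \<Lambda> D K ?\<xi> ?\<xi>)"
    by (rule sum_mono)
  then show ?thesis
    by (simp add: dissipation_hat_def seminorm_sq_def flip: sum_distrib_left)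
qed

section \<open>Mass and entropy of solutions\<close>

lemma integral_recon:
  assumes "discretisation \<Omega> D" "bounded \<Omega>"
  shows "(LINT x:\<Omega>|lebesgue. recon D v x) = (\<Sum>K\<in>cells D. volume K * cval v K)"
  using assms
  by (rule integral_piecewise_constant) (simp_all add: recon_on_cell[OF assms(1)] recon_off_cells)

lemma entropy_eq_sum:
  assumes "discretisation \<Omega> D" "bounded \<Omega>"
  shows "entropy \<Omega> D u' u = (\<Sum>K\<in>cells D. volume K * (cval u' K * \<Phi>\<^sub>1 (cval u K / cval u' K)))"
  unfolding entropy_def using assms
  by (rule integral_piecewise_constant) (simp_all add: recon_on_cell[OF assms(1)] recon_off_cells)

text \<open>The discrete gradient depends on differences of face and cell values only.\<close>

lemma scheme_form_constant:
  "scheme_form \<eta> \<Lambda> f m D u w \<lparr>cval = \<lambda>_. c, fval = \<lambda>_. c\<rparr> = 0"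
  by (simp add: scheme_form_def local_form_def discrete_grad_def avg_grad_def)

lemma positive_solution_step:
  assumes mesh: "discretisation \<Omega> D" "bounded \<Omega>"
    and sol: "positive_solution \<Omega> \<Lambda> \<phi> M \<eta> f m D dt u_in u" and "dt > 0"
  shows "(\<Sum>K\<in>cells D. volume K * ((cval (u (Suc n)) K - cval (u n) K) * cval v K))
    = - dt * scheme_form \<eta> \<Lambda> f m D (u (Suc n)) (log_ratio (u (Suc n)) (steady_state \<Omega> \<phi> M)) v"
proof -
  have "(LINT x:\<Omega>|lebesgue. (recon D (u (Suc n)) x - recon D (u n) x) * recon D v x)
      = (\<Sum>K\<in>cells D. volume K * ((cval (u (Suc n)) K - cval (u n) K) * cval v K))"
    using mesh
    by (rule integral_piecewise_constant) (simp_all add: recon_on_cell[OF mesh(1)] recon_off_cells)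
  moreover have "1 / dt * (LINT x:\<Omega>|lebesgue. (recon D (u (Suc n)) x - recon D (u n) x) * recon D v x)
        + scheme_form \<eta> \<Lambda> f m D (u (Suc n)) (log_ratio (u (Suc n)) (steady_state \<Omega> \<phi> M)) v = 0"
    using sol unfolding positive_solution_def by (metis diff_Suc_1 le_add1 plus_1_eq_Suc)
  ultimately show ?thesis using \<open>dt > 0\<close> by (simp add: field_simps)
qed

text \<open>The constant \<open>1\<close> is an admissible test vector since no flux crosses the boundary, and the diffusion
  term vanishes on it.\<close>

lemma positive_solution_mass:
  fixes \<Omega> :: "(real^'d) set"
  assumes mesh: "discretisation \<Omega> D" and bdd: "bounded \<Omega>"
    and sol: "positive_solution \<Omega> \<Lambda> \<phi> M \<eta> f m D dt u_in u" and "dt > 0"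
    and u_in: "set_integrable lebesgue \<Omega> u_in"
  shows "(\<Sum>K\<in>cells D. volume K * cval (u n) K) = (LINT x:\<Omega>|lebesgue. u_in x)"
proof (induction n)
  case 0
  have "volume K * cval (u 0) K = (LINT x:K|lebesgue. u_in x)" if "K \<in> cells D" for K
  proof -
    have "cval (u 0) K = 1 / volume K * (LINT x:K|lebesgue. u_in x)"
      using sol that unfolding positive_solution_def by blast
    moreover have "volume K \<noteq> 0" using discretisation_cellD(4)[OF mesh bdd that] by force
    ultimately show ?thesis by simp
  qed
  then show ?case
    using integral_eq_sum_cells[OF mesh bdd u_in] by simp
next
  case (Suc n)
  have "(\<Sum>K\<in>cells D. volume K * (cval (u (Suc n)) K - cval (u n) K)) = 0"
    using positive_solution_step[OF mesh bdd sol \<open>dt > 0\<close>, of n "\<lparr>cval = \<lambda>_. 1, fval = \<lambda>_. 1\<rparr>"]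
    by (simp add: scheme_form_constant)
  with Suc show ?case
    by (simp add: right_diff_distrib sum_subtractf)
qed

text \<open>Positivity at the initial time is only weak: a cell average of \<open>u_in\<close> may be zero.\<close>

lemma positive_solution_nonneg:
  fixes \<Omega> :: "(real^'d) set"
  assumes mesh: "discretisation \<Omega> D" and dom: "open \<Omega>" "bounded \<Omega>"
    and sol: "positive_solution \<Omega> \<Lambda> \<phi> M \<eta> f m D dt u_in u"
    and u_in: "AE x in lebesgue_on \<Omega>. 0 \<le> u_in x" and K: "K \<in> cells D"
  shows "0 \<le> cval (u n) K"
proof (cases n)
  case 0
  note cell = discretisation_cellD[OF mesh dom(2) K]
  have "AE x in lebesgue. x \<in> \<Omega> \<longrightarrow> 0 \<le> u_in x"
    using u_in dom lmeasurable_open[of \<Omega>] by (subst (asm) AE_restrict_space_iff) auto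
  then have "0 \<le> (LINT x:K|lebesgue. u_in x)"
    unfolding set_lebesgue_integral_def
    by (intro integral_nonneg_AE) (use cell(1) in \<open>auto elim!: eventually_mono simp: indicator_def\<close>)
  moreover have "cval (u 0) K = 1 / volume K * (LINT x:K|lebesgue. u_in x)"
    using sol K unfolding positive_solution_def by blast
  ultimately show ?thesis by (simp add: 0)
next
  case (Suc k)
  then have "positive D (u n)" using sol by (simp add: positive_solution_def)
  then show ?thesis using K by (auto simp: positive_def less_imp_le)
qed

text \<open>On each cell the increment of \<open>u' \<Phi>\<^sub>1 (u / u')\<close> is at most the increment of \<open>u\<close> times the new value of
  \<open>log (u / u')\<close>, by convexity. Summed over the cells, this is the time-derivative term of the scheme
  tested with \<open>log_ratio\<close>.\<close>

lemma entropy_dissipation_step: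
  fixes \<Omega> :: "(real^'d) set"
  assumes mesh: "discretisation \<Omega> D" and dom: "open \<Omega>" "bounded \<Omega>"
    and sol: "positive_solution \<Omega> \<Lambda> \<phi> M \<eta> f m D dt u_in u" and "dt > 0"
    and u_in: "AE x in lebesgue_on \<Omega>. 0 \<le> u_in x"
    and u'_pos: "\<And>K. K \<in> cells D \<Longrightarrow> 0 < cval (steady_state \<Omega> \<phi> M) K"
  defines "u' \<equiv> steady_state \<Omega> \<phi> M"
  shows "entropy \<Omega> D u' (u (Suc n)) + dt * dissipation \<eta> \<Lambda> f m D u' (u (Suc n))
    \<le> entropy \<Omega> D u' (u n)"
proof -
  have "entropy \<Omega> D u' (u (Suc n)) - entropy \<Omega> D u' (u n)
      \<le> (\<Sum>K\<in>cells D. volume K * ((cval (u (Suc n)) K - cval (u n) K)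
            * cval (log_ratio (u (Suc n)) u') K))"
    unfolding entropy_eq_sum[OF mesh dom(2)] sum_subtractf[symmetric]
  proof (rule sum_mono)
    fix K assume K: "K \<in> cells D"
    let ?w = "cval u' K" and ?y = "cval (u (Suc n)) K" and ?x = "cval (u n) K"
    have w: "0 < ?w" using u'_pos[OF K] by (simp add: u'_def)
    have x: "0 \<le> ?x" by (rule positive_solution_nonneg[OF mesh dom sol u_in K])
    have y: "0 < ?y" using sol K by (simp add: positive_solution_def positive_def)
    have "?w * (\<Phi>\<^sub>1 (?y / ?w) - \<Phi>\<^sub>1 (?x / ?w)) \<le> ?w * ((?y / ?w - ?x / ?w) * ln (?y / ?w))"
      using w x y by (intro mult_left_mono \<Phi>\<^sub>1_diff_le_tangent) auto
    also have "\<dots> = (?y - ?x) * ln (?y / ?w)" using w by (simp add: field_simps)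
    finally have "volume K * (?w * (\<Phi>\<^sub>1 (?y / ?w) - \<Phi>\<^sub>1 (?x / ?w))) \<le> volume K * ((?y - ?x) * ln (?y / ?w))"
      by (rule mult_left_mono) simp
    then show "volume K * (?w * \<Phi>\<^sub>1 (?y / ?w)) - volume K * (?w * \<Phi>\<^sub>1 (?x / ?w))
        \<le> volume K * ((?y - ?x) * cval (log_ratio (u (Suc n)) u') K)"
      by (simp add: log_ratio_def algebra_simps)
  qed
  also have "\<dots> = - dt * dissipation \<eta> \<Lambda> f m D u' (u (Suc n))"
    using positive_solution_step[OF mesh dom(2) sol \<open>dt > 0\<close>]
    by (simp add: dissipation_def u'_def)
  finally show ?thesis by simp
qed

text \<open>The Csiszar-Kullback inequality applied to the masses of the cells.\<close>

lemma L1_distance_le_entropy: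
  assumes mesh: "discretisation \<Omega> D" "bounded \<Omega>"
    and pos: "\<And>K. K \<in> cells D \<Longrightarrow> 0 < cval v K" "\<And>K. K \<in> cells D \<Longrightarrow> 0 < cval u' K"
    and mass: "(\<Sum>K\<in>cells D. volume K * cval v K) = M" "(\<Sum>K\<in>cells D. volume K * cval u' K) = M"
  shows "(LINT x:\<Omega>|lebesgue. \<bar>recon D v x - recon D u' x\<bar>) \<le> sqrt (2 * M * entropy \<Omega> D u' v)"
proof (rule real_le_rsqrt)
  have vol: "0 < volume K" if "K \<in> cells D" for K
    by (rule discretisation_cellD(4)[OF mesh that])
  have "(LINT x:\<Omega>|lebesgue. \<bar>recon D v x - recon D u' x\<bar>)
      = (\<Sum>K\<in>cells D. volume K * \<bar>cval v K - cval u' K\<bar>)"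
    using mesh
    by (rule integral_piecewise_constant) (simp_all add: recon_on_cell[OF mesh(1)] recon_off_cells)
  also have "\<dots> = (\<Sum>K\<in>cells D. \<bar>volume K * cval v K - volume K * cval u' K\<bar>)"
    by (simp add: abs_mult flip: right_diff_distrib)
  also have "\<dots>\<^sup>2 \<le> 2 * M * (\<Sum>K\<in>cells D. volume K * cval u' K
      * \<Phi>\<^sub>1 (volume K * cval v K / (volume K * cval u' K)))"
    using pos vol mass by (intro csiszar_kullback_sum mult_pos_pos)
  also have "(\<Sum>K\<in>cells D. volume K * cval u' K
      * \<Phi>\<^sub>1 (volume K * cval v K / (volume K * cval u' K))) = entropy \<Omega> D u' v"
    unfolding entropy_eq_sum[OF mesh]
  proof (intro sum.cong refl)
    fix K assume "K \<in> cells D"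
    from vol[OF this] have "volume K \<noteq> 0" by force
    then show "volume K * cval u' K * \<Phi>\<^sub>1 (volume K * cval v K / (volume K * cval u' K))
        = volume K * (cval u' K * \<Phi>\<^sub>1 (cval v K / cval u' K))" by simp
  qed
  finally show "(LINT x:\<Omega>|lebesgue. \<bar>recon D v x - recon D u' x\<bar>)\<^sup>2 \<le> 2 * M * entropy \<Omega> D u' v" .
qed

section \<open>Exponential decay\<close>

theorem theorem4:
  fixes \<Omega> :: "(real^'d) set"
    and \<Lambda> :: "real^'d \<Rightarrow> real^'d^'d"
    and \<phi> u_in :: "real^'d \<Rightarrow> real"
    and D :: "'d mesh"
    and u :: "nat \<Rightarrow> 'd hybrid"
    and f :: "(real^'d) set set \<Rightarrow> ((real^'d) set \<Rightarrow> real) \<Rightarrow> real"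
    and m :: "real \<Rightarrow> real \<Rightarrow> real"
    and l\<^sub>b l\<^sub>s \<omega>\<^sub>b \<omega>\<^sub>s \<eta> \<Delta>t M :: real
    and \<alpha> :: "(real^'d) set \<Rightarrow> real \<Rightarrow> real"
    and C_F :: "(real^'d \<Rightarrow> real^'d^'d) \<Rightarrow> (real^'d) set \<Rightarrow> real \<Rightarrow> real"
    and C_LS :: "real \<Rightarrow> real \<Rightarrow> (real^'d) set \<Rightarrow> real \<Rightarrow> real"
  defines "u_inf \<equiv> steady_state \<Omega> \<phi> M"
    and "\<theta> \<equiv> regularity D"
  defines "s_inf \<equiv> (SUP K\<in>cells D. cval u_inf K)"
    and "E \<equiv> (\<lambda>n. entropy \<Omega> D u_inf (u n))"
  defines "\<nu> \<equiv> 4 * (M * \<omega>\<^sub>b / (volume \<Omega> * \<omega>\<^sub>s)) * l\<^sub>b * \<alpha> \<Omega> \<theta> / (C_F \<Lambda> \<Omega> \<theta> * (C_LS M s_inf \<Omega> \<theta>)\<^sup>2)"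
  assumes dim: "CARD('d) = 2 \<or> CARD('d) = 3"
    and domain: "open \<Omega>" "bounded \<Omega>" "connected \<Omega>" "polytopal \<Omega>"
    and tensor: "diffusion_tensor \<Omega> \<Lambda> l\<^sub>b l\<^sub>s"
    and potential: "C1_closure \<Omega> \<phi>" "H_div \<Omega> (\<lambda>x. \<Lambda> x *v gradient \<phi> x)"
    and weight_bounds: "0 < \<omega>\<^sub>b" "\<omega>\<^sub>b \<le> \<omega>\<^sub>s"
      "\<And>x. x \<in> closure \<Omega> \<Longrightarrow> \<omega>\<^sub>b \<le> weight \<phi> x \<and> weight \<phi> x \<le> \<omega>\<^sub>s"
    and params: "\<Delta>t > 0" "\<eta> > 0"
    and averaging: "f = face_mean \<or> f = face_max" "admissible_mean m"
    and mesh: "discretisation \<Omega> D"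
    and initial: "L2_on \<Omega> u_in" "AE x in lebesgue_on \<Omega>. u_in x \<ge> 0"
      "M = (LINT x:\<Omega>|lebesgue. u_in x)" "M > 0"
    and solution: "positive_solution \<Omega> \<Lambda> \<phi> M \<eta> f m D \<Delta>t u_in u"
    and coercivity: "\<alpha> \<Omega> \<theta> > 0"
      "\<And>K v. K \<in> cells D \<Longrightarrow>
         \<alpha> \<Omega> \<theta> * local_seminorm_sq D K v \<le> (LINT x:K|lebesgue. (norm (discrete_grad \<eta> D K v x))\<^sup>2)"
    and fisher: "C_F \<Lambda> \<Omega> \<theta> > 0"
      "\<And>n. n \<ge> 1 \<Longrightarrow>
         dissipation_hat \<eta> \<Lambda> D u_inf (u n) \<le> C_F \<Lambda> \<Omega> \<theta> * dissipation \<eta> \<Lambda> f m D u_inf (u n)"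
    and log_sobolev: "C_LS M s_inf \<Omega> \<theta> > 0"
      "\<And>v. positive D v \<Longrightarrow> (LINT x:\<Omega>|lebesgue. recon D v x) = M \<Longrightarrow>
         (LINT x:\<Omega>|lebesgue. recon D u_inf x * \<Phi>\<^sub>1 ((recon D (sqrt_ratio v u_inf) x)\<^sup>2))
           \<le> (C_LS M s_inf \<Omega> \<theta>)\<^sup>2 * seminorm_sq D (sqrt_ratio v u_inf)"
  shows "\<nu> > 0 \<and>
    (\<forall>n. E (n + 1) \<le> inverse (1 + \<nu> * \<Delta>t) * E n) \<and>
    (\<forall>n\<ge>1. (LINT x:\<Omega>|lebesgue. \<bar>recon D (u n) x - recon D u_inf x\<bar>)
             \<le> sqrt (2 * M * E 0) * (1 + \<nu> * \<Delta>t) powr (- real n / 2))"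
proof -
  \<comment> \<open>The integral of a function that is not integrable is \<open>0\<close>, whereas \<open>M > 0\<close>.\<close>
  have u_in_int: "set_integrable lebesgue \<Omega> u_in"
    using initial(3,4) not_integrable_integral_eq
    unfolding set_integrable_def set_lebesgue_integral_def by fastforce
  have "\<Omega> \<noteq> {}" using initial(3,4) by (auto simp: set_lebesgue_integral_def)
  then have vol: "volume \<Omega> > 0"
    using domain open_not_negligible[of \<Omega>] lmeasurable_open[of \<Omega>]
    by (simp add: negligible_iff_measure zero_less_measure_iff)
  have cont: "continuous_on (closure \<Omega>) \<phi>" using potential(1) by (simp add: C1_closure_def)
  define b where "b = M * \<omega>\<^sub>b / (volume \<Omega> * \<omega>\<^sub>s)"
  have b: "b > 0" using initial(4) weight_bounds(1,2) vol by (simp add: b_def)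
  have wb: "\<forall>x\<in>closure \<Omega>. \<omega>\<^sub>b \<le> weight \<phi> x \<and> weight \<phi> x \<le> \<omega>\<^sub>s"
    using weight_bounds(3) by blast
  note steady = steady_state_bounds[OF mesh domain(1,2) vol cont weight_bounds(1) wb initial(4),
      folded b_def u_inf_def]
  have ui_pos: "0 < cval u_inf K" if "K \<in> cells D" for K
    using steady(1)[OF that] b by simp
  have lpos: "l\<^sub>b > 0" using tensor by (simp add: diffusion_tensor_def)
  define C where "C = C_LS M s_inf \<Omega> \<theta>"
  define F where "F = C_F \<Lambda> \<Omega> \<theta>"
  define a where "a = \<alpha> \<Omega> \<theta>"
  have C: "C > 0" and F: "F > 0" and a: "a > 0"
    using log_sobolev(1) fisher(1) coercivity(1) by (simp_all add: C_def F_def a_def)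
  have \<nu>_eq: "\<nu> = 4 * b * l\<^sub>b * a / (F * C\<^sup>2)"
    by (simp add: \<nu>_def b_def C_def F_def a_def)
  have \<nu>: "\<nu> > 0" using b lpos a F C by (simp add: \<nu>_eq)
  have mass: "(\<Sum>K\<in>cells D. volume K * cval (u n) K) = M" for n
    using positive_solution_mass[OF mesh domain(2) solution params(1) u_in_int] initial(3) by simp
  have pos: "positive D (u (Suc n))" for n
    using solution by (simp add: positive_solution_def)
  \<comment> \<open>The entropy equals the left-hand side of the logarithmic Sobolev inequality, as \<open>\<xi>\<^sup>2 = u / u\<^sup>\<infinity>\<close> on cells.\<close>
  have below_dissipation: "\<nu> * E (Suc n) \<le> dissipation \<eta> \<Lambda> f m D u_inf (u (Suc n))" for n
  proof -
    let ?\<xi> = "sqrt_ratio (u (Suc n)) u_inf"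
    have "(LINT x:\<Omega>|lebesgue. recon D u_inf x * \<Phi>\<^sub>1 ((recon D ?\<xi> x)\<^sup>2))
        = (\<Sum>K\<in>cells D. volume K * (cval u_inf K * \<Phi>\<^sub>1 ((cval ?\<xi> K)\<^sup>2)))"
      using mesh domain(2)
      by (rule integral_piecewise_constant) (simp_all add: recon_on_cell[OF mesh] recon_off_cells)
    also have "\<dots> = E (Suc n)"
      unfolding E_def entropy_eq_sum[OF mesh domain(2)]
    proof (intro sum.cong refl)
      fix K assume K: "K \<in> cells D"
      have "(cval ?\<xi> K)\<^sup>2 = cval (u (Suc n)) K / cval u_inf K"
        using pos[of n] ui_pos[OF K] K by (simp add: sqrt_ratio_def positive_def less_imp_le)
      then show "volume K * (cval u_inf K * \<Phi>\<^sub>1 ((cval ?\<xi> K)\<^sup>2))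
          = volume K * (cval u_inf K * \<Phi>\<^sub>1 (cval (u (Suc n)) K / cval u_inf K))" by simp
    qed
    finally have "E (Suc n) \<le> C\<^sup>2 * seminorm_sq D ?\<xi>"
      using log_sobolev(2)[OF pos[of n]] mass integral_recon[OF mesh domain(2)] by (simp add: C_def)
    then have "(4 * b * l\<^sub>b * a) * E (Suc n) \<le> (4 * b * l\<^sub>b * a) * (C\<^sup>2 * seminorm_sq D ?\<xi>)"
      using b lpos a by (intro mult_left_mono) auto
    also have "\<dots> = C\<^sup>2 * (4 * b * l\<^sub>b * a * seminorm_sq D ?\<xi>)" by simp
    also have "\<dots> \<le> C\<^sup>2 * dissipation_hat \<eta> \<Lambda> D u_inf (u (Suc n))"
      using dissipation_hat_coercive[OF mesh domain(1,2) tensor less_imp_le[OF b] steady(1,2) coercivity(2)]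
      by (intro mult_left_mono) (auto simp: a_def)
    also have "\<dots> \<le> C\<^sup>2 * (F * dissipation \<eta> \<Lambda> f m D u_inf (u (Suc n)))"
      using fisher(2)[of "Suc n"] by (intro mult_left_mono) (auto simp: F_def)
    finally show ?thesis
      using F C by (simp add: \<nu>_eq field_simps)
  qed
  have step: "E (Suc n) \<le> inverse (1 + \<nu> * \<Delta>t) * E n" for n
  proof -
    have "E (Suc n) + \<Delta>t * dissipation \<eta> \<Lambda> f m D u_inf (u (Suc n)) \<le> E n"
      using entropy_dissipation_step[OF mesh domain(1,2) solution params(1) initial(2)] ui_pos
      by (simp add: E_def u_inf_def)
    moreover have "\<Delta>t * (\<nu> * E (Suc n)) \<le> \<Delta>t * dissipation \<eta> \<Lambda> f m D u_inf (u (Suc n))"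
      using below_dissipation params(1) by (intro mult_left_mono) auto
    ultimately have "(1 + \<nu> * \<Delta>t) * E (Suc n) \<le> E n" by (simp add: algebra_simps)
    moreover have "1 + \<nu> * \<Delta>t > 0" using \<nu> params(1) by (simp add: add_pos_pos)
    ultimately show ?thesis by (simp add: field_simps)
  qed
  define q where "q = 1 + \<nu> * \<Delta>t"
  have q: "q > 0" using \<nu> params(1) by (simp add: q_def add_pos_pos)
  have decay: "E n \<le> inverse q ^ n * E 0" for n
  proof (induction n)
    case (Suc n)
    have "E (Suc n) \<le> inverse q * E n" using step by (simp add: q_def)
    also have "\<dots> \<le> inverse q * (inverse q ^ n * E 0)"
      using Suc q by (intro mult_left_mono) auto
    finally show ?case by simp
  qed simp
  have "(LINT x:\<Omega>|lebesgue. \<bar>recon D (u n) x - recon D u_inf x\<bar>)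
      \<le> sqrt (2 * M * E 0) * q powr (- real n / 2)" if "n \<ge> 1" for n
  proof -
    have "0 < cval (u n) K" if "K \<in> cells D" for K
      using solution \<open>n \<ge> 1\<close> that by (simp add: positive_solution_def positive_def)
    then have "(LINT x:\<Omega>|lebesgue. \<bar>recon D (u n) x - recon D u_inf x\<bar>) \<le> sqrt (2 * M * E n)"
      unfolding E_def by (intro L1_distance_le_entropy[OF mesh domain(2)] ui_pos mass steady(3))
    also have "\<dots> \<le> sqrt (2 * M * (inverse q ^ n * E 0))"
      using decay[of n] initial(4) by simp
    also have "\<dots> = sqrt (2 * M * E 0) * sqrt (inverse q ^ n)"
      by (simp add: real_sqrt_mult mult_ac)
    also have "sqrt (inverse q ^ n) = q powr (- real n / 2)"
    proof -
      have "inverse q ^ n = q powr (- real n)"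
        using q by (simp add: powr_minus powr_realpow power_inverse)
      then show ?thesis by (simp add: powr_half_sqrt[symmetric] powr_powr q)
    qed
    finally show ?thesis .
  qed
  with \<nu> step show ?thesis by (simp add: q_def)
qed

end
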